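(* Let $S\subset\mathbb{F}_2^n$ with $\mathbf{0}\in S$ and such that $S\setminus\{\mathbf{0}\}$ is a linearly independent set with $r$ elements. If $\#S$ is even and $r$ is odd, then $$\#B(S)=\binom{r}{(r+1)/2}\,2^{n-r}.$$ If $r$ is even, then $B(S)=\emptyset$ and $b(S)=0$.
   Context: For $\mathbf{x},\mathbf{y}\in\mathbb{F}_2^n$ the pairing is $\mathbf{x}\cdot\mathbf{y}=\sum_{i=1}^n x_iy_i\in\mathbb{F}_2$, and $H_{\mathbf{y}}=\{\mathbf{x}\in\mathbb{F}_2^n\mid \mathbf{x}\cdot\mathbf{y}=0\}$. For a nonzero $\mathbf{y}$, a set $S$ is $\mathbf{y}$-balanced if $\#(S\cap H_{\mathbf{y}})=\#S/2$. $S$ is $\mathbf{y}$-constant if $S\subset H_{\mathbf{y}}$ or $S\cap H_{\mathbf{y}}=\emptyset$. The balancing set $B(S)$ is the set of nonzero $\mathbf{y}$ such that $S$ is $\mathbf{y}$-balanced; the constant set $C(S)$ is the set of $\mathbf{y}\in\mathbb{F}_2^n$ such that $S$ is $\mathbf{y}$-constant. The balancing number is $b(S)=\#B(S)/\#C(S)$. *)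

theory Defs
  imports "HOL-Analysis.Analysis" "HOL-Library.Z2"
begin

instance bit :: finite
proof
  have "(UNIV :: bit set) \<subseteq> {0, 1}"
    by (auto intro: bit_not_zero_iff[THEN iffD1])
  then show "finite (UNIV :: bit set)"
    by (rule finite_subset) simp
qed

definition orth :: "bit ^ 'n \<Rightarrow> (bit ^ 'n) set" where
  "orth y = {x. scalar_product x y = 0}"

definition y_balanced :: "bit ^ 'n \<Rightarrow> (bit ^ 'n) set \<Rightarrow> bool" where
  "y_balanced y S \<longleftrightarrow> real (card (S \<inter> orth y)) = real (card S) / 2"

definition y_constant :: "bit ^ 'n \<Rightarrow> (bit ^ 'n) set \<Rightarrow> bool" where
  "y_constant y S \<longleftrightarrow> S \<subseteq> orth y \<or> S \<inter> orth y = {}"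

definition balancing_set :: "(bit ^ 'n) set \<Rightarrow> (bit ^ 'n) set" where
  "balancing_set S = {y. y \<noteq> 0 \<and> y_balanced y S}"

text \<open>Unlike the balancing set, the constant set ranges over all vectors; it always contains
  \<open>0\<close>, so the quotient below never has denominator \<open>0\<close>.\<close>

definition constant_set :: "(bit ^ 'n) set \<Rightarrow> (bit ^ 'n) set" where
  "constant_set S = {y. y_constant y S}"

definition balancing_number :: "(bit ^ 'n) set \<Rightarrow> real" where
  "balancing_number S = real (card (balancing_set S)) / real (card (constant_set S))"

end

theory Submission
  imports Defs
begin

text \<open>Extend \<open>T = S - {0}\<close> to a basis \<open>B\<close>. Then \<open>y \<mapsto> {b \<in> B. b \<cdot> y = 1}\<close> is a bijection from the
  space onto the subsets of \<open>B\<close>, and \<open>S\<close> is \<open>y\<close>-balanced iff the subset attached to \<open>y\<close> contains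
  exactly \<open>(r + 1) / 2\<close> of the \<open>r\<close> elements of \<open>T\<close>. The part of it in \<open>T\<close> can be chosen in
  \<open>r choose ((r + 1) / 2)\<close> ways and the part in \<open>B - T\<close> freely.\<close>

lemma CARD_bit: "CARD(bit) = 2"
proof -
  have "(UNIV :: bit set) = {0, 1}"
    by (auto intro: bit_not_zero_iff[THEN iffD1])
  then show ?thesis
    by (metis card_2_iff zero_neq_one)
qed

text \<open>Both pairings are linear in the first argument, so agreement on a spanning set extends
  to the whole space; the standard basis vectors then read off the coordinates.\<close>

lemma scalar_product_nondegenerate:
  fixes y z :: "'a::field ^ 'n"
  assumes B: "vec.span B = UNIV"
    and eq: "\<And>b. b \<in> B \<Longrightarrow> scalar_product b y = scalar_product b z"
  shows "y = z"
proof -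
  have ext: "scalar_product x y = scalar_product x z" for x
  proof (rule vec.span_induct[of x B])
    show "vec.subspace {x. scalar_product x y = scalar_product x z}"
      unfolding vec.subspace_def
      by (auto simp: scalar_product_def distrib_right sum.distrib mult.assoc sum_distrib_left[symmetric])
  qed (use B eq in auto)
  have "scalar_product (axis i 1) w = w $ i" for i and w :: "'a ^ 'n"
    by (simp add: scalar_product_def axis_def if_distrib if_distribR cong: if_cong)
  then show ?thesis
    by (metis ext vec_eq_iff)
qed

lemma card_basis_vec:
  fixes B :: "('a::field ^ 'n) set"
  assumes "vec.independent B" "vec.span B = UNIV"
  shows "card B = CARD('n)"
  by (metis assms vec.dim_span_eq_card_independent vec_dim_card)

text \<open>Injectivity is nondegeneracy of the pairing; surjectivity follows by counting.\<close>

lemma bij_betw_pairing_pattern: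
  fixes B :: "(bit ^ 'n) set"
  assumes "vec.independent B" "vec.span B = UNIV"
  shows "bij_betw (\<lambda>y. {b \<in> B. scalar_product b y = 1}) UNIV (Pow B)"
proof -
  have "inj (\<lambda>y. {b \<in> B. scalar_product b y = 1})"
  proof (rule injI)
    fix y z assume eq: "{b \<in> B. scalar_product b y = 1} = {b \<in> B. scalar_product b z = 1}"
    show "y = z"
    proof (rule scalar_product_nondegenerate[OF assms(2)])
      fix b assume "b \<in> B"
      with eq have "scalar_product b y = 1 \<longleftrightarrow> scalar_product b z = 1" by blast
      then show "scalar_product b y = scalar_product b z"
        by (metis bit_not_one_iff)
    qed
  qed
  moreover have "card (Pow B) = CARD(bit ^ 'n)"
    by (simp add: card_Pow CARD_bit card_basis_vec[OF assms])
  ultimately show ?thesis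
    unfolding bij_betw_def
    by (metis (no_types, lifting) Pow_iff card_image card_subset_eq finite_code
        image_subsetI mem_Collect_eq subsetI)
qed

lemma card_subsets_meeting_in:
  assumes "finite B" "T \<subseteq> B"
  shows "card {U. U \<subseteq> B \<and> card (T \<inter> U) = k} = (card T choose k) * 2 ^ (card B - card T)"
proof -
  have fin: "finite T" using assms finite_subset by blast
  have "bij_betw (\<lambda>(A, D). A \<union> D) ({A. A \<subseteq> T \<and> card A = k} \<times> Pow (B - T))
      {U. U \<subseteq> B \<and> card (T \<inter> U) = k}"
    \<comment> \<open>\<open>A\<close> and \<open>D\<close> lie on different sides of
      \<open>T\<close>, so cutting the union along \<open>T\<close> recovers both.\<close>
    by (rule bij_betwI[where g = "\<lambda>U. (T \<inter> U, U - T)"])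
      (use assms in \<open>auto simp: Int_Un_distrib Int_absorb1 intro!: arg_cong[where f = card]\<close>)
  then have "card {U. U \<subseteq> B \<and> card (T \<inter> U) = k} = card ({A. A \<subseteq> T \<and> card A = k} \<times> Pow (B - T))"
    by (rule bij_betw_same_card[symmetric])
  also have "\<dots> = card {A. A \<subseteq> T \<and> card A = k} * card (Pow (B - T))"
    by (rule card_cartesian_product)
  also have "\<dots> = (card T choose k) * 2 ^ (card B - card T)"
    by (simp only: n_subsets[OF fin] card_Pow finite_Diff[OF assms(1)] card_Diff_subset[OF fin assms(2)])
  finally show ?thesis .
qed

text \<open>A basis containing \<open>T\<close> turns the condition on \<open>y\<close> into one on
  the attached subset of the basis; the basis elements outside \<open>T\<close> are unrestricted and
  contribute the power of 2.\<close>

lemma card_pairing_count: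
  fixes T :: "(bit ^ 'n) set"
  assumes "vec.independent T"
  shows "card {y. card {t \<in> T. scalar_product t y = 1} = k}
    = (card T choose k) * 2 ^ (CARD('n) - card T)"
proof -
  define B where "B = vec.extend_basis T"
  have B: "T \<subseteq> B" "vec.independent B" "vec.span B = UNIV"
    unfolding B_def using assms
    by (rule vec.extend_basis_superset vec.independent_extend_basis vec.span_extend_basis; assumption)+
  let ?f = "\<lambda>y. {b \<in> B. scalar_product b y = 1}"
  have T: "{t \<in> T. scalar_product t y = 1} = T \<inter> ?f y" for y
    using B(1) by blast
  have bij: "bij_betw ?f UNIV (Pow B)"
    by (rule bij_betw_pairing_pattern[OF B(2,3)])
  have "card {y. card (T \<inter> ?f y) = k} = card {U. U \<subseteq> B \<and> card (T \<inter> U) = k}"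
  proof (rule bij_betw_same_card, rule bij_betw_subset[OF bij subset_UNIV])
    \<comment> \<open>The condition depends on \<open>y\<close> only through \<open>?f y\<close>, so
      surjectivity of \<open>?f\<close> onto \<open>Pow B\<close> identifies the image.\<close>
    have "?f ` {y. card (T \<inter> ?f y) = k} = {U \<in> range ?f. card (T \<inter> U) = k}"
      by blast
    also have "\<dots> = {U \<in> Pow B. card (T \<inter> U) = k}"
      by (simp only: bij_betw_imp_surj_on[OF bij])
    finally show "?f ` {y. card (T \<inter> ?f y) = k} = {U. U \<subseteq> B \<and> card (T \<inter> U) = k}"
      by (simp only: Pow_iff)
  qed
  moreover have "card B = CARD('n)"
    by (rule card_basis_vec[OF B(2,3)])
  ultimately show ?thesis
    unfolding T
    by (simp only: card_subsets_meeting_in[OF finite B(1)])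
qed

theorem theorem4:
  fixes S :: "(bit ^ 'n) set" and r :: nat
  assumes "0 \<in> S"
    and "vec.independent (S - {0})"
    and "card (S - {0}) = r"
  shows "(even (card S) \<and> odd r \<longrightarrow>
           card (balancing_set S) = (r choose ((r + 1) div 2)) * 2 ^ (CARD('n) - r)) \<and>
         (even r \<longrightarrow> balancing_set S = {} \<and> balancing_number S = 0)"
proof -
  let ?N = "\<lambda>y. {t \<in> S - {0}. scalar_product t y = 1}"
  have card_S: "card S = r + 1"
    using assms by (metis Suc_eq_plus1 card.remove finite_code)
  have balanced_iff: "y_balanced y S \<longleftrightarrow> 2 * card (?N y) = r + 1" for y
  proof -
    \<comment> \<open>Removing 0 from \<open>S\<close> loses nothing here: 0 pairs to 0 with every
      \<open>y\<close>, hence lies in \<open>orth y\<close>.\<close>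
    have "S - orth y = ?N y"
      by (auto simp: orth_def scalar_product_def)
    then have "card S = card (S \<inter> orth y) + card (?N y)"
      by (metis card_Int_Diff finite_code)
    then show ?thesis
      using card_S by (auto simp: y_balanced_def field_simps)
  qed
  have "card (balancing_set S) = (r choose ((r + 1) div 2)) * 2 ^ (CARD('n) - r)" if "odd r"
  proof -
    have iff: "y_balanced y S \<longleftrightarrow> card (?N y) = (r + 1) div 2" for y
      using that unfolding balanced_iff by presburger
    \<comment> \<open>For \<open>y = 0\<close> the count is 0, while \<open>r + 1\<close> is
      positive; so the condition \<open>y \<noteq> 0\<close> in \<open>balancing_set\<close>
      excludes no balanced vector.\<close>
    have "\<not> y_balanced 0 S"
      unfolding balanced_iff by (simp add: scalar_product_def)
    then have "balancing_set S = {y. y_balanced y S}"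
      unfolding balancing_set_def by blast
    then show ?thesis
      by (simp only: iff card_pairing_count[OF assms(2)] assms(3))
  qed
  moreover have "balancing_set S = {}" if "even r"
  proof -
    \<comment> \<open>Here \<open>r + 1\<close> is odd, so it cannot be twice a count.\<close>
    have "\<not> y_balanced y S" for y
      using that unfolding balanced_iff by presburger
    then show ?thesis
      unfolding balancing_set_def by blast
  qed
  ultimately show ?thesis
    unfolding balancing_number_def by (metis card.empty div_0 of_nat_0)
qed

end
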